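(* There is a constant $C>0$ such that for every $n\geq 2$ and every embedding of the link $L(n)$ in $[0,1]^3$ in which any two distinct components are at Euclidean distance at least $\varepsilon$, we have $\varepsilon\leq Cn^{-1/2}$.
   Context: $L(n)$ denotes the link consisting of $n$ distinct fibers of the Hopf fibration $S^3\to S^2$ (regarded as a link type in $[0,1]^3$); in particular every two-component sublink of $L(n)$ is a Hopf link. *)

theory Defs
  imports "HOL-Analysis.Analysis"
begin

definition is_link :: "nat \<Rightarrow> (nat \<Rightarrow> complex \<Rightarrow> real^3) \<Rightarrow> bool" where
  "is_link n \<gamma> \<longleftrightarrow>
     (\<forall>i<n. continuous_on (sphere 0 1) (\<gamma> i) \<and> inj_on (\<gamma> i) (sphere 0 1)) \<and>
     (\<forall>i<n. \<forall>j<n. i \<noteq> j \<longrightarrow> \<gamma> i ` sphere 0 1 \<inter> \<gamma> j ` sphere 0 1 = {})"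

definition link_set :: "nat \<Rightarrow> (nat \<Rightarrow> complex \<Rightarrow> real^3) \<Rightarrow> (real^3) set" where
  "link_set n \<gamma> = (\<Union>i<n. \<gamma> i ` sphere 0 1)"

definition ambient_isotopic :: "(real^3) set \<Rightarrow> (real^3) set \<Rightarrow> bool" where
  "ambient_isotopic A B \<longleftrightarrow>
     (\<exists>H :: real \<times> (real^3) \<Rightarrow> real^3.
        continuous_on ({0..1} \<times> UNIV) H \<and>
        (\<forall>t\<in>{0..1}. \<exists>g. homeomorphism UNIV UNIV (\<lambda>x. H (t, x)) g) \<and>
        (\<forall>x. H (0, x) = x) \<and>
        (\<lambda>x. H (1, x)) ` A = B)"

text \<open>Stereographic projection of S^3 (in R^4 = C^2, coordinates (Re z, Im z, Re w, Im w))
  from the pole (0,0,0,1) to R^3.\<close>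
definition stereo :: "complex \<Rightarrow> complex \<Rightarrow> real^3" where
  "stereo z w = (1 / (1 - Im w)) *\<^sub>R vector [Re z, Im z, Re w]"

text \<open>The link L(n): the n Hopf fibres through the points (cos t_k, sin t_k) of S^3,
  t_k = (k+1) pi / (2(n+1)), k < n.  These have pairwise distinct images
  cot t_k under the Hopf map (z,w) \<mapsto> z/w and avoid the fibre through the pole.
  The fibre through (z,w) is {(\<lambda>z, \<lambda>w) : |\<lambda>| = 1}; it is parametrised by \<lambda>
  and sent to R^3 by stereographic projection.\<close>
definition hopf_link :: "nat \<Rightarrow> nat \<Rightarrow> complex \<Rightarrow> real^3" where
  "hopf_link n k u =
     (let t = real (k + 1) * pi / (2 * real (n + 1))
      in stereo (u * complex_of_real (cos t)) (u * complex_of_real (sin t)))"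

end

theory Submission
  imports Defs
begin

text \<open>
  Cut the cube into cells of side about \<open>\<epsilon>/3\<close>, so that distinct components meet disjoint sets of
  cells. If no point of a component \<open>K'\<close> lay vertically above a point of a component \<open>K\<close>, then
  \<open>K\<close> could be pushed up and out of the cube in the complement of \<open>K'\<close> and contracted there, which
  is impossible for the components of a Hopf link. So for all \<open>j \<noteq> i\<close> the component \<open>K\<^sub>j\<close> meets
  a vertical column of cells through a cell of \<open>K\<^sub>i\<close>, hence \<open>n - 1\<close> is at most \<open>O(1/\<epsilon>)\<close> times the
  number of cells met by \<open>K\<^sub>i\<close>. Summing over \<open>i\<close> yields \<open>n (n - 1) = O(\<epsilon>\<^sup>-\<^sup>4)\<close>.

  That \<open>K\<close> is essential in the complement of \<open>K'\<close> is seen with the linear form on \<open>\<complex>\<^sup>2\<close> that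
  vanishes exactly on the Hopf fibre of \<open>K'\<close>: along the fibre of \<open>K\<close> it is \<open>u \<mapsto> c u\<close> with
  \<open>c \<noteq> 0\<close>.
\<close>

section \<open>Translating a linked circle to infinity\<close>

text \<open>The map \<open>z \<mapsto> sgn (z / c)\<close> sends the punctured plane to the unit
  circle and turns \<open>u \<mapsto> c * u\<close> into the identity, so a null-homotopy would
  contract the circle.\<close>

lemma scaled_circle_essential:
  fixes c :: complex
  assumes "c \<noteq> 0"
  shows "\<not> homotopic_with_canon (\<lambda>_. True) (sphere 0 1) (- {0}) (\<lambda>u. c * u) (\<lambda>_. d)"
proof
  assume "homotopic_with_canon (\<lambda>_. True) (sphere 0 1) (- {0}) (\<lambda>u. c * u) (\<lambda>_. d)"
  moreover have "continuous_on (- {0}) (\<lambda>z. sgn (z / c))"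
    using assms by (intro continuous_intros) auto
  moreover have "(\<lambda>z. sgn (z / c)) \<in> - {0} \<rightarrow> sphere 0 1"
    using assms by (auto simp: norm_sgn norm_divide)
  ultimately have "homotopic_with_canon (\<lambda>_. True) (sphere 0 1) (sphere 0 1)
      ((\<lambda>z. sgn (z / c)) \<circ> (\<lambda>u. c * u)) ((\<lambda>z. sgn (z / c)) \<circ> (\<lambda>_. d))"
    by (rule homotopic_with_compose_continuous_left)
  then have "homotopic_with_canon (\<lambda>_. True) (sphere 0 1) (sphere 0 1) id (\<lambda>_. sgn (d / c))"
    by (rule homotopic_with_eq) (use assms in \<open>auto simp: sgn_div_norm\<close>)
  then have "contractible (sphere (0::complex) 1)"
    unfolding contractible_def by blast
  then show False
    by (simp add: contractible_sphere)
qed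

text \<open>If no forward translate met the zero set, the curve could be slid far away and then
  shrunk to a point without meeting it. Composing with \<open>\<phi>\<close> would make
  \<open>u \<mapsto> c * u\<close> null-homotopic in the punctured plane.\<close>

lemma essential_circle_meets_on_translation:
  fixes \<phi> :: "'a::real_normed_vector \<Rightarrow> complex" and p :: "complex \<Rightarrow> 'a"
  assumes cont_\<phi>: "continuous_on UNIV \<phi>" and bdd: "bounded {x. \<phi> x = 0}"
    and cont_p: "continuous_on (sphere 0 1) p"
    and lin: "\<And>u. u \<in> sphere 0 1 \<Longrightarrow> \<phi> (p u) = c * u" and "c \<noteq> 0" and "v \<noteq> 0"
  shows "\<exists>u\<in>sphere 0 1. \<exists>t\<ge>0. \<phi> (p u + t *\<^sub>R v) = 0"
proof (rule ccontr)
  assume "\<not> ?thesis"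
  then have avoid: "\<phi> (p u + t *\<^sub>R v) \<noteq> 0" if "u \<in> sphere 0 1" "t \<ge> 0" for u t
    using that by blast
  obtain R where R: "\<And>x. \<phi> x = 0 \<Longrightarrow> norm x \<le> R"
    using bdd unfolding bounded_iff by blast
  have "bounded (p ` sphere 0 1)"
    using compact_continuous_image[OF cont_p compact_sphere] by (rule compact_imp_bounded)
  then obtain Q where Q: "\<And>u. u \<in> sphere 0 1 \<Longrightarrow> norm (p u) \<le> Q"
    unfolding bounded_iff by blast
  \<comment> \<open>The curve lies within \<open>Q\<close> of the origin and the zeros within
    \<open>R\<close>. The extra 1 keeps the translated curve, and all its contractions towards
    \<open>T *\<^sub>R v\<close>, strictly outside the ball of radius \<open>R\<close>.\<close>
  define T where "T = (\<bar>R\<bar> + \<bar>Q\<bar> + 1) / norm v"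
  have "T \<ge> 0"
    by (simp add: T_def)
  have Tv: "norm (T *\<^sub>R v) = \<bar>R\<bar> + \<bar>Q\<bar> + 1"
    using \<open>v \<noteq> 0\<close> by (simp add: T_def)
  let ?S = "{x. \<phi> x \<noteq> 0}"
  have "homotopic_with_canon (\<lambda>_. True) (sphere 0 1) ?S p (\<lambda>u. p u + T *\<^sub>R v)"
  proof (rule homotopic_with_linear)
    show "closed_segment (p u) (p u + T *\<^sub>R v) \<subseteq> ?S" if "u \<in> sphere 0 1" for u
    proof
      fix x assume "x \<in> closed_segment (p u) (p u + T *\<^sub>R v)"
      then obtain s where "0 \<le> s" "x = p u + (s * T) *\<^sub>R v"
        by (auto simp: in_segment algebra_simps)
      then show "x \<in> ?S"
        using avoid[OF that, of "s * T"] \<open>T \<ge> 0\<close> by simp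
    qed
  qed (intro continuous_intros cont_p)+
  \<comment> \<open>Second stage: once out of reach of the zeros, the translated curve shrinks along
    straight segments to its centre \<open>T *\<^sub>R v\<close>.\<close>
  moreover have "homotopic_with_canon (\<lambda>_. True) (sphere 0 1) ?S (\<lambda>u. p u + T *\<^sub>R v) (\<lambda>_. T *\<^sub>R v)"
  proof (rule homotopic_with_linear)
    show "closed_segment (p u + T *\<^sub>R v) (T *\<^sub>R v) \<subseteq> ?S" if "u \<in> sphere 0 1" for u
    proof
      fix x assume "x \<in> closed_segment (p u + T *\<^sub>R v) (T *\<^sub>R v)"
      then obtain s where s: "0 \<le> s" "s \<le> 1" "x = T *\<^sub>R v + (1 - s) *\<^sub>R p u"
        by (auto simp: in_segment algebra_simps)
      have "norm ((1 - s) *\<^sub>R p u) \<le> norm (p u)"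
        using s by (simp add: mult_left_le_one_le)
      then have "norm x > R"
        using Q[OF that] Tv norm_diff_ineq[of "T *\<^sub>R v" "(1 - s) *\<^sub>R p u"]
        unfolding s(3) by linarith
      then show "x \<in> ?S"
        using R[of x] by force
    qed
  qed (intro continuous_intros cont_p)+
  ultimately have "homotopic_with_canon (\<lambda>_. True) (sphere 0 1) ?S p (\<lambda>_. T *\<^sub>R v)"
    by (rule homotopic_with_trans)
  then have "homotopic_with_canon (\<lambda>_. True) (sphere 0 1) (- {0}) (\<phi> \<circ> p) (\<phi> \<circ> (\<lambda>_. T *\<^sub>R v))"
    by (rule homotopic_with_compose_continuous_left)
      (auto intro: continuous_on_subset[OF cont_\<phi>])
  then have "homotopic_with_canon (\<lambda>_. True) (sphere 0 1) (- {0}) (\<lambda>u. c * u) (\<lambda>_. \<phi> (T *\<^sub>R v))"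
    by (rule homotopic_with_eq) (use lin in auto)
  then show False
    using scaled_circle_essential[OF \<open>c \<noteq> 0\<close>] by blast
qed

section \<open>Hopf fibres\<close>

text \<open>Together with \<open>inv_stereo_snd\<close> this is the inverse of stereographic
  projection from the pole (0,0,0,1), written in the two complex coordinates of the
  3-sphere.\<close>

definition inv_stereo_fst :: "real^3 \<Rightarrow> complex" where
  "inv_stereo_fst x = Complex (2 * x$1) (2 * x$2) / of_real (x \<bullet> x + 1)"

definition inv_stereo_snd :: "real^3 \<Rightarrow> complex" where
  "inv_stereo_snd x = Complex (2 * x$3) (x \<bullet> x - 1) / of_real (x \<bullet> x + 1)"

definition hopf_angle :: "nat \<Rightarrow> nat \<Rightarrow> real" where
  "hopf_angle n k = real (k + 1) * pi / (2 * real (n + 1))"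

text \<open>The linear form sin t z - cos t w pulled back to 3-space. Its kernel is the complex line
  spanned by (cos t, sin t), which cuts the 3-sphere in a single Hopf fibre.\<close>

definition hopf_form :: "real \<Rightarrow> real^3 \<Rightarrow> complex" where
  "hopf_form t x = of_real (sin t) * inv_stereo_fst x - of_real (cos t) * inv_stereo_snd x"

lemma hopf_link_eq:
  "hopf_link n k u =
     stereo (u * of_real (cos (hopf_angle n k))) (u * of_real (sin (hopf_angle n k)))"
  by (simp add: hopf_link_def hopf_angle_def Let_def)

lemma inner_self_3: "x \<bullet> x = (x$1)\<^sup>2 + (x$2)\<^sup>2 + (x$3)\<^sup>2" for x :: "real^3"
  by (simp add: inner_vec_def sum_3 power2_eq_square)

lemma inner_self_plus_one_nonzero: "x \<bullet> x + 1 \<noteq> 0" for x :: "'a::real_inner"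
  using inner_ge_zero[of x] by linarith

lemma stereo_components:
  "stereo z w $ 1 = Re z / (1 - Im w)" "stereo z w $ 2 = Im z / (1 - Im w)"
  "stereo z w $ 3 = Re w / (1 - Im w)"
  by (simp_all add: stereo_def)

text \<open>On the 3-sphere the other three coordinates have square sum
  \<open>(1 + Im w) * (1 - Im w)\<close>, and one factor cancels against the squared
  denominator.\<close>

lemma stereo_inner_self:
  assumes "(cmod z)\<^sup>2 + (cmod w)\<^sup>2 = 1" "Im w \<noteq> 1"
  shows "stereo z w \<bullet> stereo z w = (1 + Im w) / (1 - Im w)"
proof -
  have "(Re z)\<^sup>2 + (Im z)\<^sup>2 + (Re w)\<^sup>2 = (1 + Im w) * (1 - Im w)"
    using assms(1) unfolding cmod_power2 by (simp add: algebra_simps power2_eq_square)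
  moreover have "stereo z w \<bullet> stereo z w = ((Re z)\<^sup>2 + (Im z)\<^sup>2 + (Re w)\<^sup>2) / (1 - Im w)\<^sup>2"
    by (simp add: inner_self_3 stereo_components power_divide add_divide_distrib)
  ultimately show ?thesis
    using assms(2) by (simp add: power2_eq_square)
qed

lemma inv_stereo_stereo:
  assumes "(cmod z)\<^sup>2 + (cmod w)\<^sup>2 = 1" "Im w \<noteq> 1"
  shows "inv_stereo_fst (stereo z w) = z" "inv_stereo_snd (stereo z w) = w"
proof -
  have nz: "1 - Im w \<noteq> 0" using assms by simp
  have p: "stereo z w \<bullet> stereo z w + 1 = 2 / (1 - Im w)"
    and m: "stereo z w \<bullet> stereo z w - 1 = 2 * Im w / (1 - Im w)"
    using nz by (simp_all add: stereo_inner_self[OF assms] field_simps)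
  show "inv_stereo_fst (stereo z w) = z" "inv_stereo_snd (stereo z w) = w"
    unfolding inv_stereo_fst_def inv_stereo_snd_def p m using nz
    by (simp_all add: complex_eq_iff stereo_components Re_divide_of_real Im_divide_of_real)
qed

lemma stereo_inv_stereo: "stereo (inv_stereo_fst x) (inv_stereo_snd x) = x"
proof -
  have nz: "x \<bullet> x + 1 \<noteq> 0"
    by (rule inner_self_plus_one_nonzero)
  have "Im (inv_stereo_snd x) = (x \<bullet> x - 1) / (x \<bullet> x + 1)"
    by (simp add: inv_stereo_snd_def Im_divide_of_real del: of_real_add)
  then have "1 - Im (inv_stereo_snd x) = 2 / (x \<bullet> x + 1)"
    using nz by (simp add: field_simps)
  then show ?thesis
    using nz unfolding vec_eq_iff forall_3 stereo_components
    by (simp add: inv_stereo_fst_def inv_stereo_snd_def Re_divide_of_real Im_divide_of_real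
        del: of_real_add)
qed

text \<open>This is the identity 4r + (r - 1)^2 = (r + 1)^2 for
  \<open>r = x \<bullet> x\<close>.\<close>

lemma inv_stereo_norm: "(cmod (inv_stereo_fst x))\<^sup>2 + (cmod (inv_stereo_snd x))\<^sup>2 = 1"
proof -
  have nz: "x \<bullet> x + 1 \<noteq> 0"
    by (rule inner_self_plus_one_nonzero)
  have "(cmod (inv_stereo_fst x))\<^sup>2 + (cmod (inv_stereo_snd x))\<^sup>2
      = ((2 * x$1)\<^sup>2 + (2 * x$2)\<^sup>2 + (2 * x$3)\<^sup>2 + (x \<bullet> x - 1)\<^sup>2) / (x \<bullet> x + 1)\<^sup>2"
    by (simp add: inv_stereo_fst_def inv_stereo_snd_def cmod_power2 Re_divide_of_real
        Im_divide_of_real power_divide add_divide_distrib del: of_real_add)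
  also have "(2 * x$1)\<^sup>2 + (2 * x$2)\<^sup>2 + (2 * x$3)\<^sup>2 + (x \<bullet> x - 1)\<^sup>2
      = 4 * (x \<bullet> x) + (x \<bullet> x - 1)\<^sup>2"
    by (simp add: inner_self_3 power_mult_distrib)
  also have "\<dots> = (x \<bullet> x + 1)\<^sup>2"
    by (simp add: power2_eq_square algebra_simps)
  finally show ?thesis
    using nz by simp
qed

section \<open>Hopf fibres as zero sets of linear forms\<close>

lemma continuous_hopf_form: "continuous_on UNIV (hopf_form t)"
proof -
  have *: "continuous_on UNIV (\<lambda>x::real^3. of_real (x \<bullet> x + 1) :: complex)"
    by (intro continuous_intros)
  have **: "(of_real (x \<bullet> x + 1) :: complex) \<noteq> 0" for x :: "real^3"
    using inner_self_plus_one_nonzero[of x] of_real_eq_0_iff by blast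
  show ?thesis
    unfolding hopf_form_def inv_stereo_fst_def inv_stereo_snd_def Complex_eq
    by (intro continuous_intros * ballI **)
qed

lemma hopf_angle_bounds:
  assumes "k < n"
  shows "0 < hopf_angle n k" "hopf_angle n k < pi / 2"
  using assms pi_gt_zero by (simp_all add: hopf_angle_def divide_simps)

text \<open>Two angles in (0, pi/2) differ by less than pi, and there the sine vanishes only at 0.
  This supplies the nonzero factor \<open>c\<close> of the linking argument.\<close>

lemma sin_hopf_angle_diff:
  assumes "a < n" "b < n" "a \<noteq> b"
  shows "sin (hopf_angle n a - hopf_angle n b) \<noteq> 0"
proof
  let ?d = "hopf_angle n a - hopf_angle n b"
  assume "sin ?d = 0"
  moreover have "-pi < ?d" "?d < pi"
    using hopf_angle_bounds[OF assms(1)] hopf_angle_bounds[OF assms(2)] by linarith+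
  ultimately have "?d = 0"
    by (metis sin_eq_0_pi)
  then show False
    using assms by (simp add: hopf_angle_def)
qed

text \<open>The fibre through the pole has angle pi/2; a smaller angle keeps the sine, hence the
  last coordinate, below 1.\<close>

lemma hopf_fibre_nonpole:
  assumes "k < n" "cmod u = 1"
  shows "Im (u * of_real (sin (hopf_angle n k))) \<noteq> 1"
proof -
  let ?t = "hopf_angle n k"
  have "0 < sin ?t" "sin ?t < 1"
    using hopf_angle_bounds[OF assms(1)] sin_monotone_2pi[of ?t "pi/2"]
    by (auto intro!: sin_gt_zero)
  moreover have "Im u \<le> 1"
    using abs_Im_le_cmod[of u] assms(2) by linarith
  ultimately have "Im u * sin ?t < 1"
    by (smt (verit) mult_left_le_one_le mult_nonneg_nonpos2 mult.commute mult_right_mono)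
  then show ?thesis
    by simp
qed

lemma hopf_fibre_norm:
  assumes "cmod u = 1"
  shows "(cmod (u * of_real (cos t)))\<^sup>2 + (cmod (u * of_real (sin t)))\<^sup>2 = 1"
  using assms by (simp add: norm_mult)

text \<open>The addition formula for the sine. The form vanishes on the fibre with its own angle
  \<open>t\<close>, while on every other fibre of the link it is a nonzero multiple of the
  parameter.\<close>

lemma hopf_form_hopf_link:
  assumes "k < n" "u \<in> sphere 0 1"
  shows "hopf_form t (hopf_link n k u) = of_real (sin (t - hopf_angle n k)) * u"
proof -
  have u: "cmod u = 1" using assms by simp
  show ?thesis
    unfolding hopf_form_def hopf_link_eq
      inv_stereo_stereo[OF hopf_fibre_norm[OF u] hopf_fibre_nonpole[OF assms(1) u]]
    by (simp add: sin_diff algebra_simps)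
qed

text \<open>A zero of the form has sphere coordinates proportional to (cos t, sin t); since both
  vectors have norm 1, the factor lies on the unit circle.\<close>

lemma hopf_form_zeros:
  assumes "hopf_form (hopf_angle n k) x = 0"
  shows "x \<in> hopf_link n k ` sphere 0 1"
proof -
  let ?t = "hopf_angle n k" and ?z = "inv_stereo_fst x" and ?w = "inv_stereo_snd x"
  define s c :: complex where "s = of_real (sin ?t)" and "c = of_real (cos ?t)"
  have sc: "s * s + c * c = 1"
    unfolding s_def c_def by (simp flip: of_real_mult of_real_add)
      (metis power2_eq_square sin_cos_squared_add)
  have eq: "s * ?z = c * ?w"
    using assms by (simp add: hopf_form_def s_def c_def)
  \<comment> \<open>The only candidate for the factor: the product of (z, w) with the real unit
    vector (cos t, sin t).\<close>
  define u where "u = c * ?z + s * ?w"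
  have "u * c = (s * s + c * c) * ?z - s * (s * ?z - c * ?w)"
    "u * s = (s * s + c * c) * ?w + c * (s * ?z - c * ?w)"
    by (simp_all add: u_def algebra_simps)
  then have z: "?z = u * c" and w: "?w = u * s"
    unfolding sc eq by simp_all
  have "(cmod u)\<^sup>2 = 1"
    using inv_stereo_norm[of x] unfolding z w
    by (simp add: s_def c_def norm_mult power_mult_distrib flip: distrib_left)
  then have "u \<in> sphere 0 1"
    by (simp add: power2_eq_1_iff) (use norm_ge_zero[of u] in linarith)
  moreover have "x = hopf_link n k u"
    using stereo_inv_stereo[of x] unfolding z w by (simp add: hopf_link_eq s_def c_def)
  ultimately show ?thesis
    by blast
qed

lemma continuous_hopf_link:
  assumes "k < n"
  shows "continuous_on (sphere 0 1) (hopf_link n k)"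
proof -
  let ?t = "hopf_angle n k"
  have "continuous_on (sphere 0 1) (\<lambda>u. hopf_link n k u $ i)" for i
  proof -
    have "\<forall>u\<in>sphere 0 1. 1 - Im (u * of_real (sin ?t)) \<noteq> 0"
      using hopf_fibre_nonpole[OF assms] by auto
    then have "\<forall>i. continuous_on (sphere 0 1) (\<lambda>u. hopf_link n k u $ i)"
      unfolding hopf_link_eq forall_3 stereo_components by (intro conjI continuous_intros)
    then show ?thesis ..
  qed
  then have "continuous_on (sphere 0 1) (\<lambda>u. \<chi> i. hopf_link n k u $ i)"
    by (rule continuous_on_vec_lambda)
  then show ?thesis
    by simp
qed

text \<open>At a common point the form belonging to fibre \<open>b\<close> would be both zero and
  nonzero.\<close>

lemma hopf_fibres_disjoint:
  assumes "a < n" "b < n" "a \<noteq> b"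
  shows "hopf_link n a ` sphere 0 1 \<inter> hopf_link n b ` sphere 0 1 = {}"
proof -
  have "hopf_link n a u \<noteq> hopf_link n b v" if "u \<in> sphere 0 1" "v \<in> sphere 0 1" for u v
  proof
    assume "hopf_link n a u = hopf_link n b v"
    then have "of_real (sin (hopf_angle n b - hopf_angle n a)) * u = 0"
      using hopf_form_hopf_link[OF assms(1) that(1), of "hopf_angle n b"]
        hopf_form_hopf_link[OF assms(2) that(2), of "hopf_angle n b"] by simp
    then show False
      using sin_hopf_angle_diff[OF assms(2,1)] assms(3) that(1) by auto
  qed
  then show ?thesis
    by blast
qed

section \<open>Matching components\<close>

text \<open>One piece meeting \<open>S\<close> and the union of the remaining ones, closed by
  finiteness, would otherwise separate \<open>S\<close>.\<close>

lemma connected_subset_disjoint_closed_Union: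
  assumes "connected S" "S \<noteq> {}" "finite I" "S \<subseteq> (\<Union>i\<in>I. F i)"
    and closed: "\<And>i. i \<in> I \<Longrightarrow> closed (F i)"
    and disj: "\<And>i j. \<lbrakk>i \<in> I; j \<in> I; i \<noteq> j\<rbrakk> \<Longrightarrow> F i \<inter> F j = {}"
  obtains i where "i \<in> I" "S \<subseteq> F i"
proof -
  obtain x i where x: "x \<in> S" "i \<in> I" "x \<in> F i"
    using assms by blast
  let ?G = "\<Union>j\<in>I - {i}. F j"
  have "closed ?G"
    using assms by (intro closed_UN) auto
  moreover have "S \<subseteq> F i \<union> ?G"
    using assms(4) by blast
  moreover have "F i \<inter> ?G = {}"
    using disj[OF x(2)] by blast
  ultimately have "?G \<inter> S = {}"
    using connected_closedD[OF \<open>connected S\<close>, of "F i" ?G] closed[OF x(2)] x(1,3) by auto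
  then have "S \<subseteq> F i"
    using \<open>S \<subseteq> F i \<union> ?G\<close> by blast
  then show ?thesis
    using that x by blast
qed

text \<open>Both families consist of the connected components of the same set. This is what recovers
  individual components from an isotopy that only relates their unions.\<close>

lemma disjoint_connected_Unions_match:
  assumes "finite I" "finite J" "(\<Union>i\<in>I. F i) = (\<Union>j\<in>J. G j)"
    and F: "\<And>i. i \<in> I \<Longrightarrow> closed (F i) \<and> connected (F i) \<and> F i \<noteq> {}"
    and G: "\<And>j. j \<in> J \<Longrightarrow> closed (G j) \<and> connected (G j) \<and> G j \<noteq> {}"
    and F_disj: "\<And>i j. \<lbrakk>i \<in> I; j \<in> I; i \<noteq> j\<rbrakk> \<Longrightarrow> F i \<inter> F j = {}"
    and G_disj: "\<And>i j. \<lbrakk>i \<in> J; j \<in> J; i \<noteq> j\<rbrakk> \<Longrightarrow> G i \<inter> G j = {}"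
    and i: "i \<in> I"
  obtains j where "j \<in> J" "F i = G j"
proof -
  obtain j where j: "j \<in> J" "F i \<subseteq> G j"
    by (rule connected_subset_disjoint_closed_Union[of "F i" J G]) (use assms in auto)
  obtain k where k: "k \<in> I" "G j \<subseteq> F k"
    by (rule connected_subset_disjoint_closed_Union[of "G j" I F]) (use assms j in auto)
  \<comment> \<open>The chain \<open>F i \<subseteq> G j \<subseteq> F k\<close> has a nonempty
    start, so disjointness leaves no other index.\<close>
  have "k = i"
    using F_disj[OF i k(1)] F[OF i] j k by blast
  then show ?thesis
    using that j k by blast
qed

text \<open>The homeomorphism at time 1 carries the Hopf fibres onto the components. Pulling back
  the form of the fibre behind component \<open>j\<close> gives a function that vanishes only on
  that component and is linear along component \<open>i\<close>, so translating the latter must hit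
  the former.\<close>

lemma linked_component_above:
  assumes link: "is_link n \<gamma>" and bdd: "bounded (link_set n \<gamma>)"
    and iso: "ambient_isotopic (link_set n (hopf_link n)) (link_set n \<gamma>)"
    and ij: "i < n" "j < n" "i \<noteq> j" and "v \<noteq> 0"
  shows "\<exists>x\<in>\<gamma> i ` sphere 0 1. \<exists>t\<ge>0. x + t *\<^sub>R v \<in> \<gamma> j ` sphere 0 1"
proof -
  let ?S = "sphere (0::complex) 1"
  obtain h g where hg: "homeomorphism UNIV UNIV h g"
    and img: "h ` link_set n (hopf_link n) = link_set n \<gamma>"
  proof -
    obtain H :: "real \<times> (real^3) \<Rightarrow> real^3"
      where "\<forall>t\<in>{0..1}. \<exists>g. homeomorphism UNIV UNIV (\<lambda>x. H (t, x)) g"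
        and img: "(\<lambda>x. H (1, x)) ` link_set n (hopf_link n) = link_set n \<gamma>"
      using iso unfolding ambient_isotopic_def by blast
    then obtain g where "homeomorphism UNIV UNIV (\<lambda>x. H (1, x)) g"
      by force
    then show ?thesis
      using that img by blast
  qed
  have h: "continuous_on UNIV h" and g: "continuous_on UNIV g"
    and gh: "\<And>x. g (h x) = x" and hg': "\<And>y. h (g y) = y"
    using hg unfolding homeomorphism_def by auto
  have S: "connected ?S" "?S \<noteq> {}" "compact ?S"
    by (auto simp: connected_sphere)
  have cont: "continuous_on ?S (\<gamma> k)" "continuous_on ?S (h \<circ> hopf_link n k)" if "k < n" for k
    using link that unfolding is_link_def
    by (blast intro: continuous_on_compose continuous_hopf_link[OF that]
        continuous_on_subset[OF h subset_UNIV])+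
  have comp: "closed (f ` ?S) \<and> connected (f ` ?S) \<and> f ` ?S \<noteq> {}"
    if "continuous_on ?S f" for f :: "complex \<Rightarrow> real^3"
    using S connected_continuous_image[OF that]
      compact_imp_closed[OF compact_continuous_image[OF that]] by simp
  \<comment> \<open>The isotopy may permute the numbering and change the parametrisations, so only
    equality of images with some fibre \<open>a\<close> is available.\<close>
  have match: "\<exists>a<n. \<gamma> k ` ?S = (h \<circ> hopf_link n a) ` ?S" if "k < n" for k
  proof -
    obtain a where "a \<in> {..<n}" "\<gamma> k ` ?S = (h \<circ> hopf_link n a) ` ?S"
    proof (rule disjoint_connected_Unions_match[of "{..<n}" "{..<n}"
          "\<lambda>k. \<gamma> k ` ?S" "\<lambda>a. (h \<circ> hopf_link n a) ` ?S" k])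
      show "(\<Union>k<n. \<gamma> k ` ?S) = (\<Union>a<n. (h \<circ> hopf_link n a) ` ?S)"
        using img unfolding link_set_def by (simp add: image_UN image_comp)
      show "(h \<circ> hopf_link n a) ` ?S \<inter> (h \<circ> hopf_link n b) ` ?S = {}"
        if "a \<in> {..<n}" "b \<in> {..<n}" "a \<noteq> b" for a b
      proof -
        have "inj h"
          using gh by (rule inj_on_inverseI)
        then show ?thesis
          using hopf_fibres_disjoint[of a n b] that unfolding image_comp[symmetric]
          by (simp flip: image_Int)
      qed
      show "\<gamma> a ` ?S \<inter> \<gamma> b ` ?S = {}"
        if "a \<in> {..<n}" "b \<in> {..<n}" "a \<noteq> b" for a b
        using link that unfolding is_link_def by blast
    qed (use cont comp that \<open>k < n\<close> in auto)
    then show ?thesis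
      by blast
  qed
  obtain a where a: "a < n" "\<gamma> i ` ?S = (h \<circ> hopf_link n a) ` ?S"
    using match[OF ij(1)] by blast
  obtain b where b: "b < n" "\<gamma> j ` ?S = (h \<circ> hopf_link n b) ` ?S"
    using match[OF ij(2)] by blast
  have "\<gamma> i ` ?S \<inter> \<gamma> j ` ?S = {}"
    using link ij unfolding is_link_def by blast
  then have "a \<noteq> b"
    using a b S(2) by force
  let ?\<phi> = "hopf_form (hopf_angle n b) \<circ> g"
  have zeros: "x \<in> \<gamma> j ` ?S" if "?\<phi> x = 0" for x
  proof -
    have "g x \<in> hopf_link n b ` ?S"
      using hopf_form_zeros that by simp
    then have "h (g x) \<in> (h \<circ> hopf_link n b) ` ?S"
      by (auto simp: image_iff)
    then show ?thesis
      by (simp add: b(2) hg')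
  qed
  \<comment> \<open>Component \<open>i\<close> is traversed by the transported fibre rather than by
    \<open>\<gamma> i\<close>, because the form is linear in that parameter.\<close>
  have "\<exists>u\<in>?S. \<exists>t\<ge>0. ?\<phi> ((h \<circ> hopf_link n a) u + t *\<^sub>R v) = 0"
  proof (rule essential_circle_meets_on_translation)
    show "continuous_on UNIV ?\<phi>"
      using g continuous_on_subset[OF continuous_hopf_form subset_UNIV]
      by (rule continuous_on_compose)
    show "bounded {x. ?\<phi> x = 0}"
      using zeros ij(2) by (intro bounded_subset[OF bdd]) (auto simp: link_set_def)
    show "?\<phi> ((h \<circ> hopf_link n a) u) = of_real (sin (hopf_angle n b - hopf_angle n a)) * u"
      if "u \<in> ?S" for u
      using hopf_form_hopf_link[OF a(1) that] by (simp add: gh)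
    show "(of_real (sin (hopf_angle n b - hopf_angle n a)) :: complex) \<noteq> 0"
      using sin_hopf_angle_diff[OF b(1) a(1)] \<open>a \<noteq> b\<close> by simp
  qed (use cont a \<open>v \<noteq> 0\<close> in auto)
  then show ?thesis
    using zeros a(2) by (metis imageI)
qed

section \<open>Counting cells\<close>

lemma disjoint_sets_sharing_columns_bound:
  fixes B :: "nat \<Rightarrow> ('a \<times> 'b) set"
  assumes "finite A" "finite D"
    and sub: "\<And>i. i < n \<Longrightarrow> B i \<subseteq> A \<times> D"
    and disj: "\<And>i j. \<lbrakk>i < n; j < n; i \<noteq> j\<rbrakk> \<Longrightarrow> B i \<inter> B j = {}"
    and meet: "\<And>i j. \<lbrakk>i < n; j < n; i \<noteq> j\<rbrakk> \<Longrightarrow> fst ` B i \<inter> fst ` B j \<noteq> {}"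
  shows "n * (n - 1) \<le> card A * card D * card D"
proof -
  have fin: "finite (B i)" if "i < n" for i
    using sub[OF that] assms(1,2) by (meson finite_SigmaI finite_subset)
  have bound: "n - 1 \<le> card (B i) * card D" if i: "i < n" for i
  proof -
    have "\<exists>q. q \<in> B j \<and> fst q \<in> fst ` B i" if "j \<in> {..<n} - {i}" for j
    proof -
      have "j < n" "i \<noteq> j"
        using that by auto
      from meet[OF i this] obtain c where c: "c \<in> fst ` B i" "c \<in> fst ` B j"
        by auto
      from c(2) obtain q where "c = fst q" "q \<in> B j"
        by (rule imageE)
      then show ?thesis
        using c(1) by blast
    qed
    then obtain q where q: "\<And>j. j \<in> {..<n} - {i} \<Longrightarrow> q j \<in> B j \<and> fst (q j) \<in> fst ` B i"
      by metis
    have "inj_on q ({..<n} - {i})"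
      by (rule inj_onI) (metis DiffD1 IntI disj empty_iff lessThan_iff q)
    moreover have "q ` ({..<n} - {i}) \<subseteq> fst ` B i \<times> D"
    proof
      fix y assume "y \<in> q ` ({..<n} - {i})"
      then obtain j where "j \<in> {..<n} - {i}" "y = q j"
        by blast
      then show "y \<in> fst ` B i \<times> D"
        using q[of j] sub[of j] by (auto simp: mem_Times_iff)
    qed
    ultimately have "card ({..<n} - {i}) \<le> card (fst ` B i \<times> D)"
      using fin[OF i] assms(2) by (intro card_inj_on_le) auto
    also have "\<dots> \<le> card (B i) * card D"
      using card_image_le[OF fin[OF i], of fst] by (simp add: card_cartesian_product)
    finally show ?thesis
      using i by simp
  qed
  have "n * (n - 1) \<le> (\<Sum>i<n. card (B i) * card D)"
    using sum_mono[of "{..<n}" "\<lambda>_. n - 1"] bound by fastforce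
  also have "\<dots> = card (\<Union>i<n. B i) * card D"
    using fin disj by (subst card_UN_disjoint) (auto simp: sum_distrib_right)
  also have "\<dots> \<le> card (A \<times> D) * card D"
    using assms(1,2) sub by (intro mult_right_mono card_mono) auto
  finally show ?thesis
    by (simp add: card_cartesian_product)
qed

text \<open>The pairs are nested so that \<open>fst\<close> yields the vertical column of a
  cell.\<close>

definition cell :: "nat \<Rightarrow> real^3 \<Rightarrow> (int \<times> int) \<times> int" where
  "cell N x = ((\<lfloor>N * x$1\<rfloor>, \<lfloor>N * x$2\<rfloor>), \<lfloor>N * x$3\<rfloor>)"

lemma unit_cube_component:
  fixes x :: "real^'n"
  assumes "x \<in> cbox 0 One"
  shows "0 \<le> x$i" "x$i \<le> 1"
proof -
  have "axis i (1::real) \<in> Basis"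
    by (simp add: axis_in_Basis_iff)
  then show "0 \<le> x$i" "x$i \<le> 1"
    using assms by (auto simp: mem_box inner_axis dest: bspec[where x = "axis i 1"])
qed

text \<open>The index \<open>N\<close> does occur, on the faces where a coordinate equals 1; hence
  \<open>N + 1\<close> values per direction.\<close>

lemma cell_in_range:
  assumes "x \<in> cbox 0 One"
  shows "cell N x \<in> ({0..int N} \<times> {0..int N}) \<times> {0..int N}"
proof -
  have "\<lfloor>N * x$i\<rfloor> \<in> {0..int N}" for i
  proof -
    have "0 \<le> x$i" "x$i \<le> 1"
      using unit_cube_component[OF assms] .
    then have "0 \<le> N * x$i" "N * x$i \<le> N"
      by (auto intro: mult_left_le)
    then show ?thesis
      by (simp add: floor_le_iff)
  qed
  then show ?thesis
    by (simp add: cell_def)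
qed

text \<open>Each coordinate differs by less than \<open>1 / N\<close>, and the sum of the three
  differences dominates the Euclidean distance.\<close>

lemma dist_less_if_same_cell:
  assumes "cell N x = cell N y" "N > 0"
  shows "dist x y < 3 / N"
proof -
  have "\<bar>x$i - y$i\<bar> < 1 / N" for i
  proof -
    have "\<forall>i. \<lfloor>N * x$i\<rfloor> = \<lfloor>N * y$i\<rfloor>"
      using assms(1) by (simp add: cell_def forall_3)
    then have "\<lfloor>N * x$i\<rfloor> = \<lfloor>N * y$i\<rfloor>" ..
    then have "\<bar>N * x$i - N * y$i\<bar> < 1"
      by linarith
    then have "N * \<bar>x$i - y$i\<bar> < 1"
      by (simp add: abs_mult flip: right_diff_distrib)
    then show ?thesis
      using assms(2) by (simp add: pos_less_divide_eq mult.commute)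
  qed
  then have "(\<Sum>i\<in>UNIV. \<bar>(x - y)$i\<bar>) < 1 / N + 1 / N + 1 / N"
    unfolding sum_3 vector_minus_component by (intro add_strict_mono)
  then show ?thesis
    using norm_le_l1_cart[of "x - y"] by (simp add: dist_norm)
qed

lemma dist_unit_cube_le:
  fixes x y :: "real^3"
  assumes "x \<in> cbox 0 One" "y \<in> cbox 0 One"
  shows "dist x y \<le> 3"
proof -
  have "\<bar>(x - y)$i\<bar> \<le> 1" for i
  proof -
    show ?thesis
      using unit_cube_component[OF assms(1), of i] unit_cube_component[OF assms(2), of i] by simp
  qed
  then have "(\<Sum>i\<in>UNIV. \<bar>(x - y)$i\<bar>) \<le> 1 + 1 + 1"
    unfolding sum_3 by (intro add_mono)
  then show ?thesis
    using norm_le_l1_cart[of "x - y"] by (simp add: dist_norm)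
qed

lemma separated_sharing_columns_bound:
  fixes K :: "nat \<Rightarrow> (real^3) set"
  assumes "n \<ge> 2" "\<epsilon> > 0"
    and cube: "\<And>i. i < n \<Longrightarrow> K i \<subseteq> cbox 0 One"
    and sep: "\<And>i j x y. \<lbrakk>i < n; j < n; i \<noteq> j; x \<in> K i; y \<in> K j\<rbrakk> \<Longrightarrow> \<epsilon> \<le> dist x y"
    and column: "\<And>i j. \<lbrakk>i < n; j < n; i \<noteq> j\<rbrakk> \<Longrightarrow> \<exists>x\<in>K i. \<exists>y\<in>K j. x$1 = y$1 \<and> x$2 = y$2"
  shows "\<epsilon> \<le> 12 * real n powr (-1/2)"
proof -
  \<comment> \<open>The coarsest grid with \<open>3 / N \<le> \<epsilon>\<close>: points in one cell
    are then closer than \<open>\<epsilon>\<close>, so distinct sets \<open>K i\<close> meet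
    disjoint sets of cells.\<close>
  define N where "N = nat \<lceil>3 / \<epsilon>\<rceil>"
  have N: "3 / \<epsilon> \<le> N" "N \<le> 3 / \<epsilon> + 1"
    using \<open>\<epsilon> > 0\<close> unfolding N_def by (simp_all add: of_nat_ceiling)
  have "N > 0"
    using \<open>\<epsilon> > 0\<close> by (simp add: N_def)
  \<comment> \<open>This absorbs the rounding: \<open>N + 1 \<le> 3 / \<epsilon> + 2\<close>, and 2
    is at most \<open>6 / \<epsilon>\<close>.\<close>
  have "\<epsilon> \<le> 3"
  proof -
    obtain x y where "x \<in> K 0" "y \<in> K 1"
      using column[of 0 1] \<open>n \<ge> 2\<close> by auto
    moreover have "K 0 \<subseteq> cbox 0 One" "K 1 \<subseteq> cbox 0 One"
      using cube \<open>n \<ge> 2\<close> by auto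
    ultimately have "dist x y \<le> 3" "\<epsilon> \<le> dist x y"
      using sep[of 0 1 x y] \<open>n \<ge> 2\<close> by (auto intro: dist_unit_cube_le)
    then show ?thesis
      by linarith
  qed
  then have M: "N + 1 \<le> 9 / \<epsilon>"
    using N(2) \<open>\<epsilon> > 0\<close> by (simp add: field_simps)
  define B where "B i = cell N ` K i" for i
  have "n * (n - 1) \<le> card ({0..int N} \<times> {0..int N}) * card {0..int N} * card {0..int N}"
  proof (rule disjoint_sets_sharing_columns_bound[where B = B])
    show "B i \<subseteq> ({0..int N} \<times> {0..int N}) \<times> {0..int N}" if "i < n" for i
      using cube[OF that] cell_in_range unfolding B_def by blast
    show "B i \<inter> B j = {}" if ij: "i < n" "j < n" "i \<noteq> j" for i j
    proof -
      have False if "x \<in> K i" "y \<in> K j" "cell N x = cell N y" for x y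
      proof -
        have "3 / N \<le> \<epsilon>"
          using N(1) \<open>\<epsilon> > 0\<close> \<open>N > 0\<close> by (simp add: field_simps)
        then show False
          using dist_less_if_same_cell[OF that(3) \<open>N > 0\<close>] sep[OF ij that(1,2)] by linarith
      qed
      then show ?thesis
        unfolding B_def by blast
    qed
    show "fst ` B i \<inter> fst ` B j \<noteq> {}" if "i < n" "j < n" "i \<noteq> j" for i j
    proof -
      obtain x y where xy: "x \<in> K i" "y \<in> K j" "x$1 = y$1" "x$2 = y$2"
        using column[OF \<open>i < n\<close> \<open>j < n\<close> \<open>i \<noteq> j\<close>] by blast
      have "fst (cell N x) = fst (cell N y)"
        using xy by (simp add: cell_def)
      moreover have "fst (cell N x) \<in> fst ` B i" "fst (cell N y) \<in> fst ` B j"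
        using xy unfolding B_def by blast+
      ultimately show ?thesis
        by auto
    qed
  qed auto
  then have "n * (n - 1) \<le> (N + 1) ^ 4"
    by (simp add: card_cartesian_product power4_eq_xxxx nat_add_distrib)
  then have "real (n * (n - 1)) \<le> real ((N + 1) ^ 4)"
    using of_nat_le_iff by blast
  also have "\<dots> \<le> (9 / \<epsilon>) ^ 4"
    using M by (simp add: power_mono)
  finally have "real n * (real n - 1) \<le> (9 / \<epsilon>) ^ 4"
    using \<open>n \<ge> 2\<close> by (simp add: of_nat_diff)
  \<comment> \<open>From \<open>n \<ge> 2\<close> follows \<open>n \<le> 2 * (n - 1)\<close>, which
    replaces \<open>n * (n - 1)\<close> by a square at the cost of a factor 2.\<close>
  moreover have "real n * real n \<le> real n * (2 * (real n - 1))"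
    using \<open>n \<ge> 2\<close> by (intro mult_left_mono) auto
  moreover have "real n * (2 * (real n - 1)) = 2 * (real n * (real n - 1))"
    by simp
  ultimately have "(real n)\<^sup>2 \<le> 2 * (9 / \<epsilon>) ^ 4"
    unfolding power2_eq_square by linarith
  \<comment> \<open>The constant 12 comes from 2 * 9^4 = 13122 and 12^4 = 20736; a fourth power
    allows two square roots in turn.\<close>
  also have "\<dots> \<le> ((12 / \<epsilon>)\<^sup>2)\<^sup>2"
    using \<open>\<epsilon> > 0\<close> by (simp add: power_divide field_simps flip: power_mult)
  finally have "real n \<le> (12 / \<epsilon>)\<^sup>2"
    by (rule power2_le_imp_le) simp
  then have "sqrt n \<le> 12 / \<epsilon>"
    using \<open>\<epsilon> > 0\<close> by (simp add: real_le_lsqrt)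
  then have "\<epsilon> \<le> 12 / sqrt n"
    using \<open>\<epsilon> > 0\<close> \<open>n \<ge> 2\<close> by (simp add: field_simps)
  also have "\<dots> = 12 * real n powr (-1/2)"
    using \<open>n \<ge> 2\<close> by (simp add: powr_minus_divide powr_half_sqrt)
  finally show ?thesis .
qed

theorem theorem7p1:
  shows "\<exists>C>0. \<forall>(n::nat) (\<gamma>::nat \<Rightarrow> complex \<Rightarrow> real^3) (\<epsilon>::real).
     n \<ge> 2 \<and> is_link n \<gamma> \<and> link_set n \<gamma> \<subseteq> cbox 0 One \<and>
     ambient_isotopic (link_set n (hopf_link n)) (link_set n \<gamma>) \<and>
     (\<forall>i<n. \<forall>j<n. i \<noteq> j \<longrightarrow> \<epsilon> \<le> setdist (\<gamma> i ` sphere 0 1) (\<gamma> j ` sphere 0 1))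
     \<longrightarrow> \<epsilon> \<le> C * real n powr (-1/2)"
proof (intro exI[of _ 12] conjI allI impI; (elim conjE)?)
  fix n :: nat and \<gamma> :: "nat \<Rightarrow> complex \<Rightarrow> real^3" and \<epsilon> :: real
  assume n: "n \<ge> 2" and link: "is_link n \<gamma>" and cube: "link_set n \<gamma> \<subseteq> cbox 0 One"
    and iso: "ambient_isotopic (link_set n (hopf_link n)) (link_set n \<gamma>)"
    and sep: "\<forall>i<n. \<forall>j<n. i \<noteq> j \<longrightarrow> \<epsilon> \<le> setdist (\<gamma> i ` sphere 0 1) (\<gamma> j ` sphere 0 1)"
  show "\<epsilon> \<le> 12 * real n powr (-1/2)"
  proof (cases "\<epsilon> > 0")
    case True
    show ?thesis
    proof (rule separated_sharing_columns_bound[OF n True])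
      show "\<gamma> i ` sphere 0 1 \<subseteq> cbox 0 One" if "i < n" for i
        using cube that unfolding link_set_def by blast
      show "\<epsilon> \<le> dist x y" if "i < n" "j < n" "i \<noteq> j" "x \<in> \<gamma> i ` sphere 0 1"
        "y \<in> \<gamma> j ` sphere 0 1" for i j x y
        using sep that setdist_le_dist[OF that(4,5)] by fastforce
      show "\<exists>x\<in>\<gamma> i ` sphere 0 1. \<exists>y\<in>\<gamma> j ` sphere 0 1. x$1 = y$1 \<and> x$2 = y$2"
        if "i < n" "j < n" "i \<noteq> j" for i j
      proof -
        have "bounded (link_set n \<gamma>)"
          using cube bounded_cbox bounded_subset by blast
        \<comment> \<open>Translation along the third axis preserves the first two coordinates, so a
          hit places two points in one vertical column.\<close>
        then obtain x t where "x \<in> \<gamma> i ` sphere 0 1" "x + t *\<^sub>R axis 3 1 \<in> \<gamma> j ` sphere 0 1"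
          using linked_component_above[OF link _ iso \<open>i < n\<close> \<open>j < n\<close> \<open>i \<noteq> j\<close>, of "axis 3 1"]
          by (auto simp: axis_eq_0_iff)
        moreover have "(x + t *\<^sub>R axis 3 1)$1 = x$1" "(x + t *\<^sub>R axis 3 1)$2 = x$2"
          by (simp_all add: axis_def)
        ultimately show ?thesis
          by metis
      qed
    qed
  next
    \<comment> \<open>Here the right-hand side is nonnegative and \<open>\<epsilon>\<close> is not
      positive.\<close>
    case False
    then show ?thesis
      by (smt (verit) powr_ge_zero)
  qed
qed simp

end
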